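(* Let $p$ be a prime, $d, n \in \mathbb{N}$ and $\gamma \geq 0$. Let $\{\tau_j\}_{j=1}^n$ be p-adic $\gamma$-equiangular lines in $\mathbb{Q}_p^d$, that is, vectors $\tau_1,\dots,\tau_n \in \mathbb{Q}_p^d$ such that: (i) $\langle \tau_j, \tau_j\rangle = 1$ for all $1 \leq j \leq n$; (ii) $|\langle \tau_j, \tau_k\rangle| = \gamma$ for all $1 \leq j,k \leq n$ with $j \neq k$; (iii) the $\mathbb{Q}_p$-linear operator $S_\tau : \mathbb{Q}_p^d \to \mathbb{Q}_p^d$, $S_\tau x = \sum_{j=1}^n \langle x, \tau_j\rangle \tau_j$, is similar (via an invertible $\mathbb{Q}_p$-linear operator) to a diagonal operator with eigenvalues $\lambda_1,\dots,\lambda_d \in \mathbb{Q}_p$ satisfying $\left|\sum_{j=1}^d \lambda_j\right|^2 \leq |d| \left|\sum_{j=1}^d \lambda_j^2\right|$. Then $$|n|^2 \leq |d| \max\{|n|, \gamma^2\}.$$ In particular: (i) if $|n| \leq \gamma^2$, then $|n|^2 \leq |d|\gamma^2$; (ii) if $|n| \geq \gamma^2$, then $|n| \leq |d|$.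
   Context: $\mathbb{Q}_p$ denotes the field of $p$-adic numbers with the $p$-adic absolute value $|\cdot|$; for a positive integer $m$, $|m|$ denotes the $p$-adic absolute value of $m$ regarded as an element of $\mathbb{Q}_p$. On $\mathbb{Q}_p^d$ the (bilinear) p-adic inner product is $\langle (a_j)_{j=1}^d, (b_j)_{j=1}^d\rangle = \sum_{j=1}^d a_j b_j$. *)

theory Defs
  imports "HOL-Analysis.Analysis" "Berlekamp_Zassenhaus.Finite_Field"
begin

section \<open>The p-adic absolute value on the rationals\<close>

definition padic_abs_rat :: "nat \<Rightarrow> rat \<Rightarrow> real" where
  "padic_abs_rat p x =
    (if x = 0 then 0
     else case quotient_of x of (a, b) \<Rightarrow>
       real p powi (int (multiplicity (int p) b) - int (multiplicity (int p) a)))"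

lemma padic_abs_rat_0 [simp]: "padic_abs_rat p 0 = 0"
  by (simp add: padic_abs_rat_def)

lemma padic_abs_rat_divide:
  assumes p: "prime p" and a: "a \<noteq> 0" and b: "b \<noteq> 0"
  shows "padic_abs_rat p (of_int a / of_int b) =
    real p powi (int (multiplicity (int p) b) - int (multiplicity (int p) a))"
proof -
  obtain c d where cd: "quotient_of (of_int a / of_int b) = (c, d)"
    by fastforce
  have d: "d \<noteq> 0" using quotient_of_denom_pos[OF cd] by simp
  have "(of_int a / of_int b :: rat) = of_int c / of_int d"
    by (rule quotient_of_div[OF cd])
  then have "(of_int (a * d) :: rat) = of_int (c * b)"
    using b d by (simp add: field_simps)
  then have eq: "a * d = c * b" by (simp only: of_int_eq_iff)
  then have c: "c \<noteq> 0" using a d by auto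
  have "prime_elem (int p)" using p by auto
  then have "multiplicity (int p) a + multiplicity (int p) d
      = multiplicity (int p) c + multiplicity (int p) b"
    using a b c d eq by (metis prime_elem_multiplicity_mult_distrib)
  then have "int (multiplicity (int p) d) - int (multiplicity (int p) c)
      = int (multiplicity (int p) b) - int (multiplicity (int p) a)"
    by linarith
  then show ?thesis
    using a b by (simp add: padic_abs_rat_def cd)
qed

lemma rat_fraction_cases:
  obtains a b where "(x::rat) = of_int a / of_int b" "b > 0"
  by (metis quotient_of_denom_pos quotient_of_div surj_pair)

lemma padic_abs_rat_nonneg [simp]: "padic_abs_rat p x \<ge> 0"
  by (auto simp: padic_abs_rat_def split: prod.splits)

lemma padic_abs_rat_eq_0_iff [simp]:
  "prime p \<Longrightarrow> padic_abs_rat p x = 0 \<longleftrightarrow> x = 0"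
  by (auto simp: padic_abs_rat_def power_int_eq_0_iff dest: prime_gt_0_nat split: prod.splits)

lemma padic_abs_rat_minus [simp]:
  assumes "prime p" shows "padic_abs_rat p (- x) = padic_abs_rat p x"
proof (cases "x = 0")
  case False
  obtain a b where ab: "x = of_int a / of_int b" "b > 0" by (rule rat_fraction_cases)
  with False have "a \<noteq> 0" by auto
  moreover have "multiplicity (int p) (- a) = multiplicity (int p) a"
    using multiplicity_times_unit_right[of "- 1" "int p" a] by simp
  ultimately show ?thesis
    using ab padic_abs_rat_divide[OF assms, of a b] padic_abs_rat_divide[OF assms, of "-a" b]
    by simp
qed simp

lemma padic_abs_rat_diff_commute:
  "prime p \<Longrightarrow> padic_abs_rat p (x - y) = padic_abs_rat p (y - x)"
  using padic_abs_rat_minus[of p "x - y"] by simp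

lemma padic_abs_rat_1 [simp]: "padic_abs_rat p 1 = 1"
  by (simp add: padic_abs_rat_def)

lemma padic_abs_rat_mult:
  assumes "prime p"
  shows "padic_abs_rat p (x * y) = padic_abs_rat p x * padic_abs_rat p y"
proof (cases "x = 0 \<or> y = 0")
  case False
  obtain a b where ab: "x = of_int a / of_int b" "b > 0" by (rule rat_fraction_cases)
  obtain c d where cd: "y = of_int c / of_int d" "d > 0" by (rule rat_fraction_cases)
  have nz: "a \<noteq> 0" "c \<noteq> 0" "b \<noteq> 0" "d \<noteq> 0" using ab cd False by auto
  have xy: "x * y = of_int (a * c) / of_int (b * d)" using ab cd by simp
  have pe: "prime_elem (int p)" using assms by auto
  have m: "multiplicity (int p) (a * c) = multiplicity (int p) a + multiplicity (int p) c"
    "multiplicity (int p) (b * d) = multiplicity (int p) b + multiplicity (int p) d"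
    using nz pe by (auto intro: prime_elem_multiplicity_mult_distrib)
  have p0: "real p \<noteq> 0" using assms prime_gt_0_nat by auto
  have "padic_abs_rat p (x * y) =
      real p powi (int (multiplicity (int p) (b * d)) - int (multiplicity (int p) (a * c)))"
    unfolding xy by (rule padic_abs_rat_divide[OF assms]) (use nz in auto)
  also have "int (multiplicity (int p) (b * d)) - int (multiplicity (int p) (a * c)) =
      (int (multiplicity (int p) b) - int (multiplicity (int p) a)) +
      (int (multiplicity (int p) d) - int (multiplicity (int p) c))"
    unfolding m by simp
  also have "real p powi \<dots> = padic_abs_rat p x * padic_abs_rat p y"
    unfolding ab(1) cd(1) padic_abs_rat_divide[OF assms nz(1,3)]
      padic_abs_rat_divide[OF assms nz(2,4)]
    by (rule power_int_add) (use p0 in auto)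
  finally show ?thesis .
qed auto

lemma padic_abs_rat_inverse:
  assumes "prime p" shows "padic_abs_rat p (inverse x) = inverse (padic_abs_rat p x)"
proof (cases "x = 0")
  case False
  then have "padic_abs_rat p x * padic_abs_rat p (inverse x) = 1"
    by (simp flip: padic_abs_rat_mult[OF assms])
  then show ?thesis by (metis inverse_unique)
qed simp

lemma padic_abs_rat_ultrametric:
  assumes "prime p"
  shows "padic_abs_rat p (x + y) \<le> max (padic_abs_rat p x) (padic_abs_rat p y)"
proof (cases "x = 0 \<or> y = 0 \<or> x + y = 0")
  case True
  then show ?thesis by (auto simp: le_max_iff_disj)
next
  case False
  obtain a b where ab: "x = of_int a / of_int b" "b > 0" by (rule rat_fraction_cases)
  obtain c d where cd: "y = of_int c / of_int d" "d > 0" by (rule rat_fraction_cases)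
  have x: "x = of_int (a * d) / of_int (b * d)" using ab cd by simp
  have y: "y = of_int (b * c) / of_int (b * d)" using ab cd by simp
  have xy: "x + y = of_int (a * d + b * c) / of_int (b * d)"
    using x y by (simp add: add_divide_distrib)
  have nz: "a * d \<noteq> 0" "b * c \<noteq> 0" "b * d \<noteq> 0" "a * d + b * c \<noteq> 0"
  proof -
    have "a \<noteq> 0" "c \<noteq> 0" "b \<noteq> 0" "d \<noteq> 0" using ab cd False by auto
    then show "a * d \<noteq> 0" "b * c \<noteq> 0" "b * d \<noteq> 0" by auto
    show "a * d + b * c \<noteq> 0"
      using False unfolding xy by (metis div_0 of_int_0)
  qed
  define k where "k = min (multiplicity (int p) (a * d)) (multiplicity (int p) (b * c))"
  have "int p ^ k dvd a * d + b * c"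
    unfolding k_def by (intro dvd_add multiplicity_dvd') auto
  moreover have "\<not> is_unit (int p)" using assms by auto
  ultimately have "k \<le> multiplicity (int p) (a * d + b * c)"
    using nz by (intro multiplicity_geI) auto
  moreover have "real p \<ge> 1" using assms prime_ge_1_nat by auto
  ultimately have "padic_abs_rat p (x + y) \<le>
      real p powi (int (multiplicity (int p) (b * d)) - int k)"
    unfolding xy padic_abs_rat_divide[OF assms nz(4) nz(3)]
    by (intro power_int_increasing) auto
  also have "\<dots> \<le> max (padic_abs_rat p x) (padic_abs_rat p y)"
    unfolding x y padic_abs_rat_divide[OF assms nz(1) nz(3)]
      padic_abs_rat_divide[OF assms nz(2) nz(3)] k_def
    by (cases "multiplicity (int p) (a * d) \<le> multiplicity (int p) (b * c)")
       (simp_all only: min_def max.cobounded1 max.cobounded2 if_True if_False)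
  finally show ?thesis .
qed

lemma padic_abs_rat_triangle:
  assumes "prime p"
  shows "padic_abs_rat p (x + y) \<le> padic_abs_rat p x + padic_abs_rat p y"
  using padic_abs_rat_ultrametric[OF assms, of x y]
    padic_abs_rat_nonneg[of p x] padic_abs_rat_nonneg[of p y] by linarith

lemma padic_abs_rat_diff_abs:
  assumes "prime p"
  shows "\<bar>padic_abs_rat p x - padic_abs_rat p y\<bar> \<le> padic_abs_rat p (x - y)"
  using padic_abs_rat_triangle[OF assms, of "x - y" y]
    padic_abs_rat_triangle[OF assms, of "y - x" x]
    padic_abs_rat_diff_commute[OF assms, of x y] by simp


section \<open>Null sequences and Cauchy sequences\<close>

definition padic_null :: "nat \<Rightarrow> (nat \<Rightarrow> rat) \<Rightarrow> bool" where
  "padic_null p X \<longleftrightarrow> (\<lambda>n. padic_abs_rat p (X n)) \<longlonglongrightarrow> 0"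

definition padic_cauchy :: "nat \<Rightarrow> (nat \<Rightarrow> rat) \<Rightarrow> bool" where
  "padic_cauchy p X \<longleftrightarrow> (\<forall>e>0. \<exists>k. \<forall>m\<ge>k. \<forall>n\<ge>k. padic_abs_rat p (X m - X n) < e)"

lemma padic_cauchy_const [simp]: "padic_cauchy p (\<lambda>n. c)"
  by (simp add: padic_cauchy_def)

lemma padic_null_const [simp]: "prime p \<Longrightarrow> padic_null p (\<lambda>n. c) \<longleftrightarrow> c = 0"
  by (simp add: padic_null_def LIMSEQ_const_iff)

lemma padic_null_bound:
  assumes "\<And>n. padic_abs_rat p (X n) \<le> f n" and "f \<longlonglongrightarrow> 0"
  shows "padic_null p X"
  unfolding padic_null_def
  by (rule tendsto_sandwich[OF _ _ tendsto_const assms(2)]) (use assms(1) in auto)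

lemma padic_null_add:
  assumes "prime p" "padic_null p X" "padic_null p Y"
  shows "padic_null p (\<lambda>n. X n + Y n)"
proof (rule padic_null_bound)
  show "padic_abs_rat p (X n + Y n) \<le> padic_abs_rat p (X n) + padic_abs_rat p (Y n)" for n
    by (rule padic_abs_rat_triangle[OF assms(1)])
  show "(\<lambda>n. padic_abs_rat p (X n) + padic_abs_rat p (Y n)) \<longlonglongrightarrow> 0"
    using assms(2,3) unfolding padic_null_def by (rule tendsto_add_zero)
qed

lemma padic_null_minus:
  "prime p \<Longrightarrow> padic_null p (\<lambda>n. - X n) \<longleftrightarrow> padic_null p X"
  by (simp add: padic_null_def)

lemma padic_null_diff:
  assumes "prime p" "padic_null p X" "padic_null p Y"
  shows "padic_null p (\<lambda>n. X n - Y n)"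
  using padic_null_add[OF assms(1,2), of "\<lambda>n. - Y n"] assms by (simp add: padic_null_minus)

lemma padic_cauchy_Cauchy_abs:
  assumes "prime p" "padic_cauchy p X"
  shows "Cauchy (\<lambda>n. padic_abs_rat p (X n))"
  unfolding Cauchy_def dist_real_def
proof (intro allI impI)
  fix e :: real assume "e > 0"
  then obtain k where "\<forall>m\<ge>k. \<forall>n\<ge>k. padic_abs_rat p (X m - X n) < e"
    using assms(2) unfolding padic_cauchy_def by blast
  then show "\<exists>k. \<forall>m\<ge>k. \<forall>n\<ge>k. \<bar>padic_abs_rat p (X m) - padic_abs_rat p (X n)\<bar> < e"
    using padic_abs_rat_diff_abs[OF assms(1)] le_less_trans by blast
qed

lemma padic_cauchy_convergent_abs:
  "prime p \<Longrightarrow> padic_cauchy p X \<Longrightarrow> convergent (\<lambda>n. padic_abs_rat p (X n))"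
  by (simp add: padic_cauchy_Cauchy_abs real_Cauchy_convergent)

lemma padic_cauchy_bounded:
  assumes "prime p" "padic_cauchy p X"
  obtains b where "b > 0" "\<And>n. padic_abs_rat p (X n) \<le> b"
proof -
  have "Bseq (\<lambda>n. padic_abs_rat p (X n))"
    using padic_cauchy_convergent_abs[OF assms] by (rule convergent_imp_Bseq)
  then obtain b where "b > 0" "\<forall>n. norm (padic_abs_rat p (X n)) \<le> b" by (rule BseqE)
  then show ?thesis using that by auto
qed

lemma padic_null_mult:
  assumes "prime p" "padic_cauchy p X" "padic_null p Y"
  shows "padic_null p (\<lambda>n. X n * Y n)"
proof -
  obtain b where b: "b > 0" "\<And>n. padic_abs_rat p (X n) \<le> b"
    using padic_cauchy_bounded[OF assms(1,2)] by blast
  show ?thesis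
  proof (rule padic_null_bound)
    show "padic_abs_rat p (X n * Y n) \<le> b * padic_abs_rat p (Y n)" for n
      unfolding padic_abs_rat_mult[OF assms(1)] by (rule mult_right_mono) (use b in auto)
    show "(\<lambda>n. b * padic_abs_rat p (Y n)) \<longlonglongrightarrow> 0"
      using tendsto_mult_right_zero assms(3) unfolding padic_null_def by blast
  qed
qed

lemma padic_cauchy_add:
  assumes "prime p" "padic_cauchy p X" "padic_cauchy p Y"
  shows "padic_cauchy p (\<lambda>n. X n + Y n)"
  unfolding padic_cauchy_def
proof safe
  fix e :: real assume e: "e > 0"
  obtain k l where k: "\<forall>m\<ge>k. \<forall>n\<ge>k. padic_abs_rat p (X m - X n) < e"
    and l: "\<forall>m\<ge>l. \<forall>n\<ge>l. padic_abs_rat p (Y m - Y n) < e"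
    using assms(2,3) e unfolding padic_cauchy_def by meson
  have "padic_abs_rat p (X m + Y m - (X n + Y n)) < e"
    if "m \<ge> max k l" "n \<ge> max k l" for m n
  proof -
    have "padic_abs_rat p (X m - X n) < e" "padic_abs_rat p (Y m - Y n) < e"
      using k l that by auto
    then show ?thesis
      unfolding add_diff_add
      using padic_abs_rat_ultrametric[OF assms(1), of "X m - X n" "Y m - Y n"] by linarith
  qed
  then show "\<exists>k. \<forall>m\<ge>k. \<forall>n\<ge>k. padic_abs_rat p (X m + Y m - (X n + Y n)) < e" by blast
qed

lemma padic_cauchy_minus:
  assumes "prime p" "padic_cauchy p X"
  shows "padic_cauchy p (\<lambda>n. - X n)"
proof -
  have "padic_abs_rat p (- X m - - X n) = padic_abs_rat p (X m - X n)" for m n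
    using padic_abs_rat_diff_commute[OF assms(1)] by simp
  then show ?thesis using assms(2) by (simp add: padic_cauchy_def)
qed

lemma padic_cauchy_mult:
  assumes "prime p" "padic_cauchy p X" "padic_cauchy p Y"
  shows "padic_cauchy p (\<lambda>n. X n * Y n)"
  unfolding padic_cauchy_def
proof safe
  fix e :: real assume e: "e > 0"
  obtain a where a: "a > 0" "\<And>n. padic_abs_rat p (X n) \<le> a"
    using padic_cauchy_bounded[OF assms(1,2)] by blast
  obtain b where b: "b > 0" "\<And>n. padic_abs_rat p (Y n) \<le> b"
    using padic_cauchy_bounded[OF assms(1,3)] by blast
  have "e / b > 0" "e / a > 0" using a b e by auto
  then obtain k l where k: "\<forall>m\<ge>k. \<forall>n\<ge>k. padic_abs_rat p (X m - X n) < e / b"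
    and l: "\<forall>m\<ge>l. \<forall>n\<ge>l. padic_abs_rat p (Y m - Y n) < e / a"
    using assms(2,3) unfolding padic_cauchy_def by meson
  have "padic_abs_rat p (X m * Y m - X n * Y n) < e"
    if mn: "m \<ge> max k l" "n \<ge> max k l" for m n
  proof -
    have "padic_abs_rat p (X m * (Y m - Y n)) \<le> a * padic_abs_rat p (Y m - Y n)"
      unfolding padic_abs_rat_mult[OF assms(1)] by (rule mult_right_mono) (use a in auto)
    also have "\<dots> < a * (e / a)"
      using l mn a(1) by (intro mult_strict_left_mono) auto
    finally have 1: "padic_abs_rat p (X m * (Y m - Y n)) < e" using a(1) by simp
    have "padic_abs_rat p ((X m - X n) * Y n) \<le> padic_abs_rat p (X m - X n) * b"
      unfolding padic_abs_rat_mult[OF assms(1)] by (rule mult_left_mono) (use b in auto)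
    also have "\<dots> < (e / b) * b"
      using k mn b(1) by (intro mult_strict_right_mono) auto
    finally have 2: "padic_abs_rat p ((X m - X n) * Y n) < e" using b(1) by simp
    show ?thesis
      unfolding mult_diff_mult
      using padic_abs_rat_ultrametric[OF assms(1), of "X m * (Y m - Y n)" "(X m - X n) * Y n"] 1 2
      by linarith
  qed
  then show "\<exists>k. \<forall>m\<ge>k. \<forall>n\<ge>k. padic_abs_rat p (X m * Y m - X n * Y n) < e" by blast
qed

lemma padic_cauchy_not_null:
  assumes "prime p" "padic_cauchy p X" "\<not> padic_null p X"
  obtains b k where "b > 0" "\<And>n. n \<ge> k \<Longrightarrow> padic_abs_rat p (X n) > b"
proof -
  obtain L where L: "(\<lambda>n. padic_abs_rat p (X n)) \<longlonglongrightarrow> L"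
    using padic_cauchy_convergent_abs[OF assms(1,2)] unfolding convergent_def by blast
  have "L \<ge> 0" by (rule LIMSEQ_le_const[OF L]) auto
  moreover have "L \<noteq> 0" using L assms(3) unfolding padic_null_def by auto
  ultimately have L0: "L > 0" by simp
  then have "\<forall>\<^sub>F n in sequentially. padic_abs_rat p (X n) > L / 2"
    by (intro order_tendstoD(1)[OF L]) auto
  then obtain k where "\<And>n. n \<ge> k \<Longrightarrow> padic_abs_rat p (X n) > L / 2"
    unfolding eventually_sequentially by blast
  with L0 show ?thesis by (intro that[of "L / 2" k]) auto
qed

lemma padic_cauchy_inverse:
  assumes "prime p" "padic_cauchy p X" "\<not> padic_null p X"
  shows "padic_cauchy p (\<lambda>n. inverse (X n))"
  unfolding padic_cauchy_def
proof safe
  fix e :: real assume e: "e > 0"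
  obtain b k where b: "b > 0" "\<And>n. n \<ge> k \<Longrightarrow> padic_abs_rat p (X n) > b"
    using padic_cauchy_not_null[OF assms] by blast
  have "b * e * b > 0" using b e by simp
  then obtain l where l: "\<forall>m\<ge>l. \<forall>n\<ge>l. padic_abs_rat p (X m - X n) < b * e * b"
    using assms(2) unfolding padic_cauchy_def by meson
  have "padic_abs_rat p (inverse (X m) - inverse (X n)) < e"
    if mn: "m \<ge> max k l" "n \<ge> max k l" for m n
  proof -
    have bm: "padic_abs_rat p (X m) > b" and bn: "padic_abs_rat p (X n) > b"
      using b mn by auto
    then have nz: "X m \<noteq> 0" "X n \<noteq> 0" using b(1) by auto
    have "padic_abs_rat p (inverse (X m) - inverse (X n))
        = padic_abs_rat p (X m - X n) / (padic_abs_rat p (X m) * padic_abs_rat p (X n))"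
      by (simp add: inverse_diff_inverse[OF nz] padic_abs_rat_mult padic_abs_rat_inverse
          assms(1) divide_inverse mult_ac)
    also have "\<dots> \<le> padic_abs_rat p (X m - X n) / (b * b)"
      using bm bn b(1) by (intro divide_left_mono mult_mono mult_pos_pos) auto
    also have "\<dots> < (b * e * b) / (b * b)"
      using l mn b(1) by (intro divide_strict_right_mono) auto
    also have "\<dots> = e" using b(1) by simp
    finally show ?thesis .
  qed
  then show "\<exists>k. \<forall>m\<ge>k. \<forall>n\<ge>k. padic_abs_rat p (inverse (X m) - inverse (X n)) < e" by blast
qed

lemma padic_null_inverse_diff:
  assumes p: "prime p" and X: "padic_cauchy p X" "\<not> padic_null p X"
    and Y: "padic_cauchy p Y" "\<not> padic_null p Y" and XY: "padic_null p (\<lambda>n. X n - Y n)"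
  shows "padic_null p (\<lambda>n. inverse (X n) - inverse (Y n))"
proof -
  obtain a k where a: "a > 0" "\<And>n. n \<ge> k \<Longrightarrow> padic_abs_rat p (X n) > a"
    using padic_cauchy_not_null[OF p X] by blast
  obtain b l where b: "b > 0" "\<And>n. n \<ge> l \<Longrightarrow> padic_abs_rat p (Y n) > b"
    using padic_cauchy_not_null[OF p Y] by blast
  have "padic_null p (\<lambda>n. (inverse (X n) * inverse (Y n)) * (X n - Y n))"
    by (intro padic_null_mult padic_cauchy_mult padic_cauchy_inverse p X Y XY)
  then have lim: "(\<lambda>n. padic_abs_rat p (inverse (X n) * inverse (Y n) * (X n - Y n))) \<longlonglongrightarrow> 0"
    by (simp add: padic_null_def)
  show ?thesis
    unfolding padic_null_def
  proof (rule Lim_transform_eventually[OF lim])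
    show "\<forall>\<^sub>F n in sequentially. padic_abs_rat p (inverse (X n) * inverse (Y n) * (X n - Y n))
        = padic_abs_rat p (inverse (X n) - inverse (Y n))"
      unfolding eventually_sequentially
    proof (intro exI allI impI)
      fix n assume "n \<ge> max k l"
      then have "padic_abs_rat p (X n) > 0" "padic_abs_rat p (Y n) > 0"
        using a b by (meson less_trans max.boundedE)+
      then have nz: "X n \<noteq> 0" "Y n \<noteq> 0" by auto
      show "padic_abs_rat p (inverse (X n) * inverse (Y n) * (X n - Y n))
          = padic_abs_rat p (inverse (X n) - inverse (Y n))"
        unfolding inverse_diff_inverse[OF nz] using p by (simp add: mult_ac)
    qed
  qed
qed


section \<open>The field of p-adic numbers\<close>

text \<open>
  The prime is the cardinality of the type parameter: \<open>'p padic\<close> is the field of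
  \<open>CARD('p)\<close>-adic numbers, the completion of the rationals (Cauchy sequences modulo
  null sequences) with respect to the p-adic absolute value for \<open>p = CARD('p)\<close>.
\<close>

typedef (overloaded) 'p padic_seq = "{X. padic_cauchy CARD('p::prime_card) X}"
  by (rule exI[of _ "\<lambda>n. 0"]) simp

setup_lifting type_definition_padic_seq

instantiation padic_seq :: (prime_card) comm_ring_1
begin

lift_definition zero_padic_seq :: "'a padic_seq" is "\<lambda>n. 0"
  by simp

lift_definition one_padic_seq :: "'a padic_seq" is "\<lambda>n. 1"
  by simp

lift_definition plus_padic_seq :: "'a padic_seq \<Rightarrow> 'a padic_seq \<Rightarrow> 'a padic_seq"
  is "\<lambda>X Y n. X n + Y n"
  by (rule padic_cauchy_add[OF prime_card])

lift_definition uminus_padic_seq :: "'a padic_seq \<Rightarrow> 'a padic_seq" is "\<lambda>X n. - X n"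
  by (rule padic_cauchy_minus[OF prime_card])

lift_definition minus_padic_seq :: "'a padic_seq \<Rightarrow> 'a padic_seq \<Rightarrow> 'a padic_seq"
  is "\<lambda>X Y n. X n - Y n"
  unfolding diff_conv_add_uminus
  by (intro padic_cauchy_add padic_cauchy_minus prime_card)

lift_definition times_padic_seq :: "'a padic_seq \<Rightarrow> 'a padic_seq \<Rightarrow> 'a padic_seq"
  is "\<lambda>X Y n. X n * Y n"
  by (rule padic_cauchy_mult[OF prime_card])

instance
  by standard (transfer; simp add: algebra_simps fun_eq_iff)+

end

lift_definition padic_null_seq :: "'p::prime_card padic_seq \<Rightarrow> bool" is "padic_null CARD('p)" .

lift_definition padic_inverse_seq :: "'p::prime_card padic_seq \<Rightarrow> 'p padic_seq"
  is "\<lambda>X. if padic_null CARD('p) X then (\<lambda>n. 0) else (\<lambda>n. inverse (X n))"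
  by (simp add: padic_cauchy_inverse prime_card)

lift_definition padic_abs_seq :: "'p::prime_card padic_seq \<Rightarrow> real"
  is "\<lambda>X. lim (\<lambda>n. padic_abs_rat CARD('p) (X n))" .

lemma padic_null_seq_0 [simp]: "padic_null_seq 0"
  by transfer (simp add: prime_card)

lemma padic_null_seq_1 [simp]: "\<not> padic_null_seq 1"
  by transfer (simp add: prime_card)

lemma padic_null_seq_add: "padic_null_seq x \<Longrightarrow> padic_null_seq y \<Longrightarrow> padic_null_seq (x + y)"
  by transfer (rule padic_null_add[OF prime_card])

lemma padic_null_seq_minus [simp]: "padic_null_seq (- x) \<longleftrightarrow> padic_null_seq x"
  by transfer (rule padic_null_minus[OF prime_card])

lemma padic_null_seq_diff: "padic_null_seq x \<Longrightarrow> padic_null_seq y \<Longrightarrow> padic_null_seq (x - y)"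
  by transfer (rule padic_null_diff[OF prime_card])

lemma padic_null_seq_mult: "padic_null_seq y \<Longrightarrow> padic_null_seq (x * y)"
  by transfer (rule padic_null_mult[OF prime_card])

lemma padic_null_inverse_seq:
  assumes "\<not> padic_null_seq x" shows "padic_null_seq (padic_inverse_seq x * x - 1)"
  using assms
proof transfer
  fix X :: "nat \<Rightarrow> rat"
  assume X: "padic_cauchy CARD('a) X" and nz: "\<not> padic_null CARD('a) X"
  obtain b k where b: "b > 0" "\<And>n. n \<ge> k \<Longrightarrow> padic_abs_rat CARD('a) (X n) > b"
    using padic_cauchy_not_null[OF prime_card X nz] by blast
  have "inverse (X n) * X n - 1 = 0" if "n \<ge> k" for n
  proof -
    have "X n \<noteq> 0" using b(1) b(2)[OF that] by auto
    then show ?thesis by simp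
  qed
  then have "\<forall>\<^sub>F n in sequentially. padic_abs_rat CARD('a) (inverse (X n) * X n - 1) = 0"
    unfolding eventually_sequentially by (metis padic_abs_rat_0)
  then have "padic_null CARD('a) (\<lambda>n. inverse (X n) * X n - 1)"
    unfolding padic_null_def by (rule tendsto_eventually)
  then show "padic_null CARD('a)
      (\<lambda>n. (if padic_null CARD('a) X then (\<lambda>n. 0) else (\<lambda>n. inverse (X n))) n * X n - 1)"
    using nz by simp
qed

quotient_type (overloaded) 'p padic = "'p::prime_card padic_seq" / "\<lambda>x y. padic_null_seq (x - y)"
proof (rule equivpI)
  show "reflp (\<lambda>x y :: 'p padic_seq. padic_null_seq (x - y))"
    by (simp add: reflp_def)
  show "symp (\<lambda>x y :: 'p padic_seq. padic_null_seq (x - y))"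
    by (rule sympI) (metis minus_diff_eq padic_null_seq_minus)
  show "transp (\<lambda>x y :: 'p padic_seq. padic_null_seq (x - y))"
    by (rule transpI) (metis diff_add_cancel add_diff_eq padic_null_seq_add)
qed

instantiation padic :: (prime_card) field
begin

lift_definition zero_padic :: "'a padic" is 0 .

lift_definition one_padic :: "'a padic" is 1 .

lift_definition plus_padic :: "'a padic \<Rightarrow> 'a padic \<Rightarrow> 'a padic" is "(+)"
  unfolding add_diff_add by (rule padic_null_seq_add)

lift_definition uminus_padic :: "'a padic \<Rightarrow> 'a padic" is uminus
  unfolding minus_diff_minus padic_null_seq_minus .

lift_definition minus_padic :: "'a padic \<Rightarrow> 'a padic \<Rightarrow> 'a padic" is "(-)"
proof -
  fix x x' y y' :: "'a padic_seq"
  assume "padic_null_seq (x - x')" "padic_null_seq (y - y')"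
  then have "padic_null_seq ((x - x') - (y - y'))" by (rule padic_null_seq_diff)
  also have "(x - x') - (y - y') = x - y - (x' - y')" by simp
  finally show "padic_null_seq (x - y - (x' - y'))" .
qed

lift_definition times_padic :: "'a padic \<Rightarrow> 'a padic \<Rightarrow> 'a padic" is "(*)"
proof -
  fix x x' y y' :: "'a padic_seq"
  assume "padic_null_seq (x - x')" "padic_null_seq (y - y')"
  then have "padic_null_seq (x * (y - y') + y' * (x - x'))"
    by (intro padic_null_seq_add padic_null_seq_mult)
  also have "x * (y - y') + y' * (x - x') = x * y - x' * y'"
    by (simp add: algebra_simps)
  finally show "padic_null_seq (x * y - x' * y')" .
qed

lift_definition inverse_padic :: "'a padic \<Rightarrow> 'a padic" is padic_inverse_seq
proof transfer
  fix X Y :: "nat \<Rightarrow> rat"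
  assume X: "padic_cauchy CARD('a) X" and Y: "padic_cauchy CARD('a) Y"
    and XY: "padic_null CARD('a) (\<lambda>n. X n - Y n)"
  have "padic_null CARD('a) X \<longleftrightarrow> padic_null CARD('a) Y"
    using padic_null_diff[OF prime_card _ XY, of X] padic_null_add[OF prime_card _ XY, of Y]
    by auto
  then show "padic_null CARD('a) (\<lambda>n.
      (if padic_null CARD('a) X then (\<lambda>n. 0) else (\<lambda>n. inverse (X n))) n -
      (if padic_null CARD('a) Y then (\<lambda>n. 0) else (\<lambda>n. inverse (Y n))) n)"
    using padic_null_inverse_diff[OF prime_card X _ Y _ XY] by (auto simp: prime_card)
qed

definition divide_padic :: "'a padic \<Rightarrow> 'a padic \<Rightarrow> 'a padic" where
  "divide_padic x y = x * inverse y"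

instance
proof
  fix a b c :: "'a padic"
  show "a + b + c = a + (b + c)" by transfer (simp add: algebra_simps)
  show "a + b = b + a" by transfer (simp add: algebra_simps)
  show "0 + a = a" by transfer simp
  show "- a + a = 0" by transfer simp
  show "a - b = a + - b" by transfer simp
  show "a * b * c = a * (b * c)" by transfer (simp add: algebra_simps)
  show "a * b = b * a" by transfer (simp add: algebra_simps)
  show "1 * a = a" by transfer simp
  show "(a + b) * c = a * c + b * c" by transfer (simp add: algebra_simps)
  show "(0::'a padic) \<noteq> 1" by transfer simp
  show "a \<noteq> 0 \<Longrightarrow> inverse a * a = 1" by transfer (simp add: padic_null_inverse_seq)
  show "a div b = a * inverse b" by (rule divide_padic_def)
  show "inverse (0::'a padic) = 0"
    by transfer (transfer; simp add: prime_card)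
qed

end

lift_definition padic_abs :: "'p::prime_card padic \<Rightarrow> real" is padic_abs_seq
proof transfer
  fix X Y :: "nat \<Rightarrow> rat"
  let ?a = "padic_abs_rat CARD('p)"
  assume Y: "padic_cauchy CARD('p) Y" and "padic_null CARD('p) (\<lambda>n. X n - Y n)"
  then have XY: "(\<lambda>n. ?a (X n - Y n)) \<longlonglongrightarrow> 0" by (simp add: padic_null_def)
  obtain L where L: "(\<lambda>n. ?a (Y n)) \<longlonglongrightarrow> L"
    using padic_cauchy_convergent_abs[OF prime_card Y] unfolding convergent_def by blast
  have "(\<lambda>n. ?a (X n) - ?a (Y n)) \<longlonglongrightarrow> 0"
    by (rule tendsto_0_le[OF XY, of _ 1])
       (auto intro!: always_eventually padic_abs_rat_diff_abs prime_card)
  from tendsto_add[OF this L] have "(\<lambda>n. ?a (X n)) \<longlonglongrightarrow> L" by simp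
  with L show "lim (\<lambda>n. ?a (X n)) = lim (\<lambda>n. ?a (Y n))"
    by (simp add: limI)
qed

lemma padic_abs_of_nat:
  "padic_abs (of_nat m :: 'p::prime_card padic) = padic_abs_rat CARD('p) (of_nat m)"
proof -
  have 1: "(of_nat m :: 'p padic) = abs_padic (of_nat m)"
    by (induction m) (simp_all add: zero_padic_def one_padic_def plus_padic.abs_eq)
  have 2: "Rep_padic_seq (of_nat m :: 'p padic_seq) = (\<lambda>n. of_nat m)"
    by (induction m) (simp_all add: zero_padic_seq.rep_eq one_padic_seq.rep_eq plus_padic_seq.rep_eq)
  show ?thesis by (simp add: 1 2 padic_abs.abs_eq padic_abs_seq.rep_eq)
qed

lemma padic_abs_mult:
  "padic_abs (x * y) = padic_abs x * padic_abs (y :: 'p::prime_card padic)"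
proof (transfer, transfer)
  fix X Y :: "nat \<Rightarrow> rat"
  assume X: "padic_cauchy CARD('p) X" and Y: "padic_cauchy CARD('p) Y"
  note lims = padic_cauchy_convergent_abs[OF prime_card, THEN convergent_LIMSEQ_iff[THEN iffD1]]
  from tendsto_mult[OF lims[OF X] lims[OF Y]]
  show "lim (\<lambda>n. padic_abs_rat CARD('p) (X n * Y n)) =
      lim (\<lambda>n. padic_abs_rat CARD('p) (X n)) * lim (\<lambda>n. padic_abs_rat CARD('p) (Y n))"
    by (simp add: padic_abs_rat_mult prime_card limI)
qed

lemma padic_abs_ultrametric:
  "padic_abs (x + y) \<le> max (padic_abs x) (padic_abs (y :: 'p::prime_card padic))"
proof (transfer, transfer)
  fix X Y :: "nat \<Rightarrow> rat"
  assume X: "padic_cauchy CARD('p) X" and Y: "padic_cauchy CARD('p) Y"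
  note lims = padic_cauchy_convergent_abs[OF prime_card, THEN convergent_LIMSEQ_iff[THEN iffD1]]
  show "lim (\<lambda>n. padic_abs_rat CARD('p) (X n + Y n)) \<le>
      max (lim (\<lambda>n. padic_abs_rat CARD('p) (X n))) (lim (\<lambda>n. padic_abs_rat CARD('p) (Y n)))"
    by (rule LIMSEQ_le[OF lims[OF padic_cauchy_add[OF prime_card X Y]]
          tendsto_max[OF lims[OF X] lims[OF Y]]])
       (intro exI allI impI padic_abs_rat_ultrametric prime_card)
qed


section \<open>Equiangular lines\<close>

definition padic_inner :: "'p::prime_card padic ^ 'd \<Rightarrow> 'p padic ^ 'd \<Rightarrow> 'p padic" where
  "padic_inner a b = (\<Sum>j\<in>UNIV. a $ j * b $ j)"

definition frame_operator ::
  "nat \<Rightarrow> (nat \<Rightarrow> 'p::prime_card padic ^ 'd) \<Rightarrow> 'p padic ^ 'd \<Rightarrow> 'p padic ^ 'd" where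
  "frame_operator n \<tau> x = (\<Sum>j=1..n. padic_inner x (\<tau> j) *s \<tau> j)"

definition diagonal_operator :: "('d \<Rightarrow> 'a::times) \<Rightarrow> 'a ^ 'd \<Rightarrow> 'a ^ 'd" where
  "diagonal_operator ev x = (\<chi> i. ev i * x $ i)"

definition similar_operators :: "('a::field ^ 'd \<Rightarrow> 'a ^ 'd) \<Rightarrow> ('a ^ 'd \<Rightarrow> 'a ^ 'd) \<Rightarrow> bool" where
  "similar_operators A B \<longleftrightarrow>
    (\<exists>T. Vector_Spaces.linear (*s) (*s) T \<and> bij T \<and> A = T \<circ> B \<circ> inv_into UNIV T)"

definition padic_equiangular_lines ::
  "real \<Rightarrow> nat \<Rightarrow> (nat \<Rightarrow> 'p::prime_card padic ^ 'd) \<Rightarrow> bool" where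
  "padic_equiangular_lines \<gamma> n \<tau> \<longleftrightarrow>
    (\<forall>j\<in>{1..n}. padic_inner (\<tau> j) (\<tau> j) = 1) \<and>
    (\<forall>j\<in>{1..n}. \<forall>k\<in>{1..n}. j \<noteq> k \<longrightarrow> padic_abs (padic_inner (\<tau> j) (\<tau> k)) = \<gamma>) \<and>
    (\<exists>ev :: 'd \<Rightarrow> 'p padic.
      similar_operators (frame_operator n \<tau>) (diagonal_operator ev) \<and>
      (padic_abs (\<Sum>j\<in>UNIV. ev j))\<^sup>2
        \<le> padic_abs (of_nat CARD('d) :: 'p padic) * padic_abs (\<Sum>j\<in>UNIV. (ev j)\<^sup>2))"

end

theory Submission
  imports Defs
begin

text \<open>
  The trace of the frame operator is \<open>n\<close> and the trace of its square is
  \<open>\<Sum>j k. \<langle>\<tau> j, \<tau> k\<rangle>\<^sup>2\<close>, where the ultrametric inequality bounds the diagonal part by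
  \<open>\<bar>n\<bar>\<close> and the off-diagonal part by \<open>\<gamma>\<^sup>2\<close>. By similarity these traces are the sums of the
  eigenvalues and of their squares, so the hypothesis on the eigenvalues gives the bound.
\<close>

lemma padic_abs_nonneg: "padic_abs (x :: 'p::prime_card padic) \<ge> 0"
proof (transfer, transfer)
  fix X :: "nat \<Rightarrow> rat"
  assume "padic_cauchy CARD('p) X"
  then have "(\<lambda>n. padic_abs_rat CARD('p) (X n)) \<longlonglongrightarrow> lim (\<lambda>n. padic_abs_rat CARD('p) (X n))"
    by (simp add: padic_cauchy_convergent_abs prime_card flip: convergent_LIMSEQ_iff)
  then show "0 \<le> lim (\<lambda>n. padic_abs_rat CARD('p) (X n))"
    by (rule LIMSEQ_le_const) simp
qed

lemma padic_abs_0: "padic_abs (0 :: 'p::prime_card padic) = 0"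
  using padic_abs_of_nat[of 0, where 'p = 'p] by simp

lemma padic_abs_power2: "padic_abs (x\<^sup>2) = (padic_abs (x :: 'p::prime_card padic))\<^sup>2"
  by (simp add: power2_eq_square padic_abs_mult)

text \<open>Iterating the ultrametric inequality keeps the bound of a single term, with no factor
  for the number of terms. The assumption \<open>B \<ge> 0\<close> covers the sums that are 0 by
  default, over an empty or an infinite \<open>A\<close>.\<close>

lemma padic_abs_sum_le:
  fixes f :: "'a \<Rightarrow> 'p::prime_card padic"
  assumes "\<And>x. x \<in> A \<Longrightarrow> padic_abs (f x) \<le> B" and "B \<ge> 0"
  shows "padic_abs (sum f A) \<le> B"
  using assms
proof (induction A rule: infinite_finite_induct)
  case (insert x A)
  then have "padic_abs (f x) \<le> B" "padic_abs (sum f A) \<le> B" by auto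
  then show ?case
    using insert.hyps padic_abs_ultrametric[of "f x" "sum f A"] by simp
qed (auto simp: padic_abs_0)

text \<open>Since \<open>A = P ** B ** Q\<close>, cyclicity of the trace moves \<open>P\<close> to
  the right of \<open>Q\<close>, where the two cancel: a right inverse of a square matrix is also a
  left inverse. Similarity is stated as the intertwining relation \<open>A ** P = P ** B\<close>
  because this form passes directly to squares.\<close>

lemma trace_similar:
  fixes A B P :: "'a::field ^ 'n ^ 'n"
  assumes AP: "A ** P = P ** B" and PQ: "P ** Q = mat 1"
  shows "trace A = trace B"
proof -
  have "A = A ** (P ** Q)" by (simp add: PQ)
  also have "\<dots> = P ** (B ** Q)" by (simp add: AP matrix_mul_assoc)
  finally have "trace A = trace (B ** Q ** P)" by (simp only: trace_mul_sym[of P])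
  also have "\<dots> = trace (B ** (Q ** P))" by (simp add: matrix_mul_assoc)
  also have "Q ** P = mat 1" using PQ by (simp only: matrix_left_right_inverse)
  finally show ?thesis by simp
qed

text \<open>With \<open>P\<close> the matrix of the similarity, \<open>A ** P = P ** B\<close>, and
  applying this twice gives \<open>A ** A ** P = A ** P ** B = P ** (B ** B)\<close>. Hence the same
  \<open>P\<close> serves for both traces.\<close>

lemma similar_operators_imp_traces:
  fixes A B :: "'a::field ^ 'n ^ 'n"
  assumes "similar_operators ((*v) A) ((*v) B)"
  shows "trace A = trace B" and "trace (A ** A) = trace (B ** B)"
proof -
  obtain T where T: "Vector_Spaces.linear (*s) (*s) T" "bij T"
    and eq: "(*v) A = T \<circ> (*v) B \<circ> inv_into UNIV T"
    using assms unfolding similar_operators_def by blast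
  define P where "P = matrix T"
  have P: "T = (*v) P"
    unfolding P_def using T(1) by (simp add: fun_eq_iff matrix_works)
  \<comment> \<open>Evaluating the similarity at \<open>T x\<close> makes
    \<open>inv_into UNIV T\<close> cancel.\<close>
  have "A *v (P *v x) = P *v (B *v x)" for x
    using fun_cong[OF eq, of "T x"] T(2) P by (simp add: bij_is_inj)
  then have AP: "A ** P = P ** B"
    by (simp add: matrix_eq flip: matrix_vector_mul_assoc)
  have "surj ((*v) P)" using T(2) P bij_is_surj by blast
  then obtain Q where Q: "P ** Q = mat 1"
    using matrix_right_invertible_surjective by blast
  show "trace A = trace B" using AP Q by (rule trace_similar)
  have "A ** A ** P = P ** (B ** B)"
    by (simp add: AP matrix_mul_assoc flip: matrix_mul_assoc[of A A P])
  then show "trace (A ** A) = trace (B ** B)" using Q by (rule trace_similar)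
qed

text \<open>This is the sum of the outer products of the \<open>\<tau> j\<close> with themselves,
  that is, V times its transpose, where V has the \<open>\<tau> j\<close> as columns.\<close>

definition frame_matrix :: "nat \<Rightarrow> (nat \<Rightarrow> 'p::prime_card padic ^ 'd) \<Rightarrow> 'p padic ^ 'd ^ 'd" where
  "frame_matrix n \<tau> = (\<chi> i k. \<Sum>j=1..n. \<tau> j $ i * \<tau> j $ k)"

lemma frame_operator_eq_matrix: "frame_operator n \<tau> = (*v) (frame_matrix n \<tau>)"
proof
  fix x
  show "frame_operator n \<tau> x = frame_matrix n \<tau> *v x"
    unfolding vec_eq_iff
  proof
    fix i
    have "frame_operator n \<tau> x $ i = (\<Sum>j=1..n. \<Sum>k\<in>UNIV. \<tau> j $ i * \<tau> j $ k * x $ k)"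
      by (simp add: frame_operator_def padic_inner_def sum_distrib_left mult_ac)
    also have "\<dots> = (\<Sum>k\<in>UNIV. \<Sum>j=1..n. \<tau> j $ i * \<tau> j $ k * x $ k)"
      by (rule sum.swap)
    also have "\<dots> = (frame_matrix n \<tau> *v x) $ i"
      by (simp add: frame_matrix_def matrix_vector_mult_def sum_distrib_right)
    finally show "frame_operator n \<tau> x $ i = (frame_matrix n \<tau> *v x) $ i" .
  qed
qed

lemma trace_frame_matrix:
  "trace (frame_matrix n \<tau>) = (\<Sum>j=1..n. padic_inner (\<tau> j) (\<tau> j))"
  unfolding trace_def frame_matrix_def padic_inner_def vec_lambda_beta by (rule sum.swap)

text \<open>The product of the outer products of \<open>\<tau> j\<close> and of
  \<open>\<tau> k\<close> has trace \<open>(padic_inner (\<tau> j) (\<tau> k))\<^sup>2\<close>;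
  summing over all pairs gives the claim.\<close>

lemma trace_frame_matrix_square:
  "trace (frame_matrix n \<tau> ** frame_matrix n \<tau>)
    = (\<Sum>j=1..n. \<Sum>k=1..n. (padic_inner (\<tau> j) (\<tau> k))\<^sup>2)"
proof -
  let ?f = "\<lambda>i l j k. \<tau> j $ i * \<tau> j $ l * (\<tau> k $ l * \<tau> k $ i)"
  have "trace (frame_matrix n \<tau> ** frame_matrix n \<tau>)
      = (\<Sum>i\<in>UNIV. \<Sum>l\<in>UNIV. \<Sum>j=1..n. \<Sum>k=1..n. ?f i l j k)"
    by (simp add: trace_def frame_matrix_def matrix_matrix_mult_def sum_product)
  \<comment> \<open>Four swaps bring the coordinate indices i and l innermost. For fixed j and k,
    the summand then separates into a factor in i and a factor in l, each summing to the same inner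
    product.\<close>
  also have "\<dots> = (\<Sum>i\<in>UNIV. \<Sum>j=1..n. \<Sum>l\<in>UNIV. \<Sum>k=1..n. ?f i l j k)"
    by (intro sum.cong refl sum.swap)
  also have "\<dots> = (\<Sum>j=1..n. \<Sum>i\<in>UNIV. \<Sum>l\<in>UNIV. \<Sum>k=1..n. ?f i l j k)"
    by (rule sum.swap)
  also have "\<dots> = (\<Sum>j=1..n. \<Sum>i\<in>UNIV. \<Sum>k=1..n. \<Sum>l\<in>UNIV. ?f i l j k)"
    by (intro sum.cong refl sum.swap)
  also have "\<dots> = (\<Sum>j=1..n. \<Sum>k=1..n. \<Sum>i\<in>UNIV. \<Sum>l\<in>UNIV. ?f i l j k)"
    by (intro sum.cong refl sum.swap)
  also have "\<dots> = (\<Sum>j=1..n. \<Sum>k=1..n. (padic_inner (\<tau> j) (\<tau> k))\<^sup>2)"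
    by (simp add: padic_inner_def power2_eq_square sum_product mult_ac)
  finally show ?thesis .
qed

definition diagonal_matrix :: "('d \<Rightarrow> 'a::zero) \<Rightarrow> 'a ^ 'd ^ 'd" where
  "diagonal_matrix ev = (\<chi> i k. if i = k then ev i else 0)"

lemma diagonal_operator_eq_matrix:
  "diagonal_operator ev = (*v) (diagonal_matrix ev :: 'a::semiring_1 ^ 'd ^ 'd)"
  by (simp add: fun_eq_iff vec_eq_iff diagonal_operator_def diagonal_matrix_def
      matrix_vector_mult_def if_distrib[of "\<lambda>x. x * _"] cong: if_cong)

lemma trace_diagonal_matrix:
  "trace (diagonal_matrix ev :: 'a::semiring_1 ^ 'd ^ 'd) = (\<Sum>i\<in>UNIV. ev i)"
  by (simp add: trace_def diagonal_matrix_def)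

lemma trace_diagonal_matrix_square:
  "trace (diagonal_matrix ev ** diagonal_matrix ev :: 'a::semiring_1 ^ 'd ^ 'd) = (\<Sum>i\<in>UNIV. (ev i)\<^sup>2)"
  by (simp add: trace_def diagonal_matrix_def matrix_matrix_mult_def power2_eq_square
      if_distrib[of "\<lambda>x. x * _"] cong: if_cong)

lemma padic_abs_sum_inner_squares_le:
  fixes \<tau> :: "nat \<Rightarrow> 'p::prime_card padic ^ 'd"
  assumes "padic_equiangular_lines \<gamma> n \<tau>"
  shows "padic_abs (\<Sum>j=1..n. \<Sum>k=1..n. (padic_inner (\<tau> j) (\<tau> k))\<^sup>2)
    \<le> max (padic_abs (of_nat n :: 'p padic)) (\<gamma>\<^sup>2)"
proof -
  let ?g = "\<lambda>j k. (padic_inner (\<tau> j) (\<tau> k))\<^sup>2"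
  have diag: "?g j j = 1" if "j \<in> {1..n}" for j
    using assms that by (simp add: padic_equiangular_lines_def)
  have off: "padic_abs (?g j k) = \<gamma>\<^sup>2" if "j \<in> {1..n}" "k \<in> {1..n} - {j}" for j k
    using assms that unfolding padic_equiangular_lines_def padic_abs_power2 by auto
  \<comment> \<open>The diagonal ones are first collected into the single element
    \<open>of_nat n\<close>. Bounding them term by term would only give 1, while the absolute value
    of n may be smaller.\<close>
  have "(\<Sum>j=1..n. \<Sum>k=1..n. ?g j k) = (\<Sum>j=1..n. 1 + (\<Sum>k\<in>{1..n} - {j}. ?g j k))"
    by (intro sum.cong refl) (simp add: sum.remove diag)
  also have "\<dots> = of_nat n + (\<Sum>j=1..n. \<Sum>k\<in>{1..n} - {j}. ?g j k)"
    by (simp add: sum.distrib)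
  finally have split: "(\<Sum>j=1..n. \<Sum>k=1..n. ?g j k)
      = of_nat n + (\<Sum>j=1..n. \<Sum>k\<in>{1..n} - {j}. ?g j k)" .
  \<comment> \<open>The sum bound is applied to the outer and then to the inner sum. It also holds
    for \<open>n \<le> 1\<close>, where no off-diagonal term exists.\<close>
  have "padic_abs (\<Sum>j=1..n. \<Sum>k\<in>{1..n} - {j}. ?g j k) \<le> \<gamma>\<^sup>2"
    by (intro padic_abs_sum_le) (auto simp: off)
  then show ?thesis
    unfolding split
    using padic_abs_ultrametric[of "of_nat n" "\<Sum>j=1..n. \<Sum>k\<in>{1..n} - {j}. ?g j k"]
    by linarith
qed

theorem mainTheorem1:
  fixes \<tau> :: "nat \<Rightarrow> 'p::prime_card padic ^ 'd" and n :: nat and \<gamma> :: real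
  assumes "\<gamma> \<ge> 0"
    and "padic_equiangular_lines \<gamma> n \<tau>"
  shows "(padic_abs (of_nat n :: 'p padic))\<^sup>2
      \<le> padic_abs (of_nat CARD('d) :: 'p padic) * max (padic_abs (of_nat n :: 'p padic)) (\<gamma>\<^sup>2)
    \<and> (padic_abs (of_nat n :: 'p padic) \<le> \<gamma>\<^sup>2 \<longrightarrow>
        (padic_abs (of_nat n :: 'p padic))\<^sup>2 \<le> padic_abs (of_nat CARD('d) :: 'p padic) * \<gamma>\<^sup>2)
    \<and> (padic_abs (of_nat n :: 'p padic) \<ge> \<gamma>\<^sup>2 \<longrightarrow>
        padic_abs (of_nat n :: 'p padic) \<le> padic_abs (of_nat CARD('d) :: 'p padic))"
proof -
  let ?n = "padic_abs (of_nat n :: 'p padic)"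
  let ?d = "padic_abs (of_nat CARD('d) :: 'p padic)"
  obtain ev :: "'d \<Rightarrow> 'p padic" where
    sim: "similar_operators (frame_operator n \<tau>) (diagonal_operator ev)"
    and ev: "(padic_abs (\<Sum>j\<in>UNIV. ev j))\<^sup>2 \<le> ?d * padic_abs (\<Sum>j\<in>UNIV. (ev j)\<^sup>2)"
    using assms(2) unfolding padic_equiangular_lines_def by blast
  note traces = similar_operators_imp_traces[OF
      sim[unfolded frame_operator_eq_matrix diagonal_operator_eq_matrix]]
  \<comment> \<open>Both power sums of the eigenvalues are now computed from the frame side of the
    trace identities.\<close>
  have "(\<Sum>j\<in>UNIV. ev j) = (\<Sum>j=1..n. padic_inner (\<tau> j) (\<tau> j))"
    using traces(1) by (simp add: trace_frame_matrix trace_diagonal_matrix)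
  also have "\<dots> = of_nat n"
    using assms(2) by (simp add: padic_equiangular_lines_def)
  finally have sum1: "(\<Sum>j\<in>UNIV. ev j) = of_nat n" .
  have sum2: "(\<Sum>j\<in>UNIV. (ev j)\<^sup>2) = (\<Sum>j=1..n. \<Sum>k=1..n. (padic_inner (\<tau> j) (\<tau> k))\<^sup>2)"
    using traces(2) by (simp only: trace_frame_matrix_square trace_diagonal_matrix_square)
  have "?n\<^sup>2 \<le> ?d * padic_abs (\<Sum>j=1..n. \<Sum>k=1..n. (padic_inner (\<tau> j) (\<tau> k))\<^sup>2)"
    using ev unfolding sum1 sum2 .
  also have "\<dots> \<le> ?d * max ?n (\<gamma>\<^sup>2)"
    by (intro mult_left_mono padic_abs_sum_inner_squares_le assms(2) padic_abs_nonneg)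
  finally have main: "?n\<^sup>2 \<le> ?d * max ?n (\<gamma>\<^sup>2)" .
  moreover have "?n\<^sup>2 \<le> ?d * \<gamma>\<^sup>2" if "?n \<le> \<gamma>\<^sup>2"
    using main that by (simp add: max_def split: if_splits)
  moreover have "?n \<le> ?d" if "?n \<ge> \<gamma>\<^sup>2"
  \<comment> \<open>The bound becomes \<open>?n * ?n \<le> ?d * ?n\<close>, and cancelling
    \<open>?n\<close> requires it to be positive; if it is 0, only \<open>0 \<le> ?d\<close> remains
    to be shown.\<close>
  proof (cases "?n = 0")
    case True
    then show ?thesis by (simp add: padic_abs_nonneg)
  next
    case False
    then have "?n > 0" using padic_abs_nonneg less_eq_real_def by metis
    moreover have "?n * ?n \<le> ?d * ?n"
      using main that by (simp add: max_absorb1 power2_eq_square)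
    ultimately show ?thesis by simp
  qed
  ultimately show ?thesis by blast
qed

end
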